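(* Let $G=\mathrm{SL}_2(\mathbb C)$ and let $T$ be the subgroup of diagonal matrices. For $\alpha\in\mathbb C$ put $g_\alpha=\begin{pmatrix}1&\alpha\\1&1+\alpha\end{pmatrix}$, and let $$\mathcal K=\{a+bi\in\mathbb C\mid a,b\in\mathbb R,\ a\ge-\tfrac12\}\setminus\{-\tfrac12+bi\mid b\in\mathbb R,\ b<0\}.$$ Then the set of pairs $$\{(T,T)\}\cup\{(g_\alpha Tg_\alpha^{-1},T)\mid\alpha\in\mathcal K\}$$ is a minimal set of representatives of the orbits of pairs of maximal tori of $G$ under simultaneous conjugation by elements of $G$; that is, every pair of maximal tori of $G$ is conjugate under $G$ to one of these pairs, and the pairs $(T,T)$ and $(g_\alpha Tg_\alpha^{-1},T)$, $\alpha\in\mathcal K$, lie in pairwise distinct $G$-orbits.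
   Context: $G$ acts on pairs $(T_1,T_2)$ of maximal tori by $g\cdot(T_1,T_2)=(gT_1g^{-1},gT_2g^{-1})$. *)

theory Defs
  imports "HOL-Analysis.Analysis" "HOL-Algebra.Product_Groups" "HOL-Algebra.Group_Action"
begin

text \<open>The \<open>\<complex>\<close>-algebra of functions generated by a set of coordinate functions.\<close>

inductive_set alg_generated :: "('a \<Rightarrow> complex) set \<Rightarrow> ('a \<Rightarrow> complex) set"
  for X :: "('a \<Rightarrow> complex) set"
  where
    const: "(\<lambda>_. c) \<in> alg_generated X"
  | gen: "f \<in> X \<Longrightarrow> f \<in> alg_generated X"
  | add: "f \<in> alg_generated X \<Longrightarrow> g \<in> alg_generated X \<Longrightarrow> (\<lambda>x. f x + g x) \<in> alg_generated X"
  | mult: "f \<in> alg_generated X \<Longrightarrow> g \<in> alg_generated X \<Longrightarrow> (\<lambda>x. f x * g x) \<in> alg_generated X"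

text \<open>
  An affine variety is given by its set of points \<open>V\<close> and an algebra \<open>A\<close> of functions whose
  restrictions to \<open>V\<close> form the coordinate ring. Values of functions in \<open>A\<close> outside \<open>V\<close> are
  irrelevant. A map is a morphism iff it pulls regular functions back to regular functions.
\<close>

definition variety_morphism ::
    "'a set \<Rightarrow> ('a \<Rightarrow> complex) set \<Rightarrow> 'b set \<Rightarrow> ('b \<Rightarrow> complex) set \<Rightarrow> ('a \<Rightarrow> 'b) \<Rightarrow> bool"
  where "variety_morphism V A W B f \<longleftrightarrow>
    f \<in> V \<rightarrow> W \<and> (\<forall>q\<in>B. \<exists>p\<in>A. \<forall>x\<in>V. q (f x) = p x)"

definition mat_poly_funs :: "(complex^2^2 \<Rightarrow> complex) set"
  where "mat_poly_funs = alg_generated {\<lambda>M. M $ i $ j | i j. True}"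

definition laurent_funs :: "nat \<Rightarrow> ((nat \<Rightarrow> complex) \<Rightarrow> complex) set"
  where "laurent_funs n =
    alg_generated ({\<lambda>x. x i | i. i < n} \<union> {\<lambda>x. inverse (x i) | i. i < n})"

definition mult_group :: "complex monoid"
  where "mult_group = \<lparr>carrier = UNIV - {0}, monoid.mult = (*), one = 1\<rparr>"

text \<open>The standard torus \<open>(\<complex>\<^sup>*)\<^sup>n\<close>; its coordinate ring is given by \<^const>\<open>laurent_funs\<close>.\<close>

definition std_torus :: "nat \<Rightarrow> (nat \<Rightarrow> complex) monoid"
  where "std_torus n = product_group {..<n} (\<lambda>_. mult_group)"

definition SL2 :: "(complex^2^2) monoid"
  where "SL2 = \<lparr>carrier = {M. det M = 1}, monoid.mult = (**), one = mat 1\<rparr>"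

lemma group_SL2: "group SL2"
proof (rule groupI)
  fix M assume M: "M \<in> carrier SL2"
  then have "invertible M"
    by (simp add: SL2_def invertible_det_nz)
  then obtain N where N: "M ** N = mat 1" "N ** M = mat 1"
    by (auto simp: invertible_def)
  from N(2) have "det N * det M = 1"
    by (metis det_mul det_I)
  with M N(2) show "\<exists>N\<in>carrier SL2. N \<otimes>\<^bsub>SL2\<^esub> M = \<one>\<^bsub>SL2\<^esub>"
    by (auto simp: SL2_def)
qed (auto simp: SL2_def det_mul det_I matrix_mul_assoc)

definition closed_in_SL2 :: "(complex^2^2) set \<Rightarrow> bool"
  where "closed_in_SL2 S \<longleftrightarrow>
    (\<exists>P \<subseteq> mat_poly_funs. S = {M \<in> carrier SL2. \<forall>p\<in>P. p M = 0})"

text \<open>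
  A torus is a closed subgroup that is isomorphic to some \<open>(\<complex>\<^sup>*)\<^sup>n\<close> as an algebraic group,
  i.e. by a group isomorphism that is a morphism of varieties in both directions.
\<close>

definition is_torus :: "(complex^2^2) set \<Rightarrow> bool"
  where "is_torus S \<longleftrightarrow> subgroup S SL2 \<and> closed_in_SL2 S \<and>
    (\<exists>n. \<exists>\<phi> \<in> iso (std_torus n) (SL2\<lparr>carrier := S\<rparr>).
       variety_morphism (carrier (std_torus n)) (laurent_funs n) S mat_poly_funs \<phi> \<and>
       variety_morphism S mat_poly_funs (carrier (std_torus n)) (laurent_funs n)
         (inv_into (carrier (std_torus n)) \<phi>))"

definition maximal_torus :: "(complex^2^2) set \<Rightarrow> bool"
  where "maximal_torus S \<longleftrightarrow> is_torus S \<and> (\<forall>S'. is_torus S' \<and> S \<subseteq> S' \<longrightarrow> S' = S)"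

definition torus_pairs :: "((complex^2^2) set \<times> (complex^2^2) set) set"
  where "torus_pairs = {(S1, S2). maximal_torus S1 \<and> maximal_torus S2}"

definition conj_set :: "complex^2^2 \<Rightarrow> (complex^2^2) set \<Rightarrow> (complex^2^2) set"
  where "conj_set g S = g <#\<^bsub>SL2\<^esub> S #>\<^bsub>SL2\<^esub> (inv\<^bsub>SL2\<^esub> g)"

definition conj_pair ::
    "complex^2^2 \<Rightarrow> (complex^2^2) set \<times> (complex^2^2) set \<Rightarrow> (complex^2^2) set \<times> (complex^2^2) set"
  where "conj_pair g = (\<lambda>(S1, S2). (conj_set g S1, conj_set g S2))"

definition minimal_orbit_reps ::
    "('g, 'm) monoid_scheme \<Rightarrow> 'e set \<Rightarrow> ('g \<Rightarrow> 'e \<Rightarrow> 'e) \<Rightarrow> 'e set \<Rightarrow> bool"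
  where "minimal_orbit_reps G E act R \<longleftrightarrow>
    R \<subseteq> E \<and> (\<forall>Q \<in> orbits G E act. R \<inter> Q \<noteq> {}) \<and>
    (\<forall>R'. R' \<subset> R \<longrightarrow> (\<exists>Q \<in> orbits G E act. R' \<inter> Q = {}))"

definition diag_torus :: "(complex^2^2) set"
  where "diag_torus = {M \<in> carrier SL2. M $ 1 $ 2 = 0 \<and> M $ 2 $ 1 = 0}"

definition gmat :: "complex \<Rightarrow> complex^2^2"
  where "gmat \<alpha> = vector [vector [1, \<alpha>], vector [1, 1 + \<alpha>]]"

definition param_region :: "complex set"
  where "param_region =
    {Complex a b | a b. a \<ge> - 1/2} - {Complex (- 1/2) b | b. b < 0}"

end

theory Submission
  imports Defs "HOL-Computational_Algebra.Polynomial"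
begin

text \<open>
  Write \<open>T\<close> for the diagonal torus. The maximal tori are exactly the conjugates of \<open>T\<close>
  (\<open>maximal_torus_iff_conj_diag_torus\<close>). A torus is commutative, so once it contains an element
  with two distinct eigenvalues it lies in the centralizer of that element, which is a conjugate
  of \<open>T\<close>. Otherwise all its elements have trace \<open>\<plusminus>2\<close>, and then it consists of scalars, because a
  torus contains no unipotent \<open>u \<noteq> 1\<close>: the entries of \<open>u\<^sup>k\<close> are polynomials in \<open>k\<close>, whereas a
  coordinate of the torus takes the value \<open>c\<^sup>k\<close> at \<open>u\<^sup>k\<close>, and both \<open>c\<^sup>k\<close> and \<open>c\<^sup>-\<^sup>k\<close> can be
  polynomial in \<open>k\<close> only for \<open>c = 1\<close> (\<open>torus_unipotent_eq_one\<close>).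

  Every pair of maximal tori is therefore conjugate to some \<open>(k T k\<^sup>-\<^sup>1, T)\<close>. The matrix \<open>k\<close> may be
  multiplied on both sides by elements of the normalizer of \<open>T\<close>. If both entries of some column
  of \<open>k\<close> are nonzero, one may exchange columns and assume that it is the first;
  diagonal matrices then bring \<open>k\<close> to the form \<open>gmat \<alpha>\<close>, where \<open>\<alpha>\<close> is the product of the two
  off-diagonal entries of \<open>k\<close>, and a Weyl element on the left replaces \<open>\<alpha>\<close> by \<open>-1 - \<alpha>\<close>. Otherwise \<open>k\<close> itself normalizes \<open>T\<close>. The region \<open>param_region\<close>
  is a fundamental domain for the point reflection \<open>\<alpha> \<mapsto> -1 - \<alpha>\<close> about \<open>-1/2\<close>, which gives the
  normal forms.

  For the separation of orbits, consider \<open>(tr (M N))\<^sup>2\<close> with \<open>M\<close>, \<open>N\<close> traceless elements of the first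
  and the second torus. Such \<open>M\<close> and \<open>N\<close> are unique up to sign, so this number is an invariant of
  the pair. It equals \<open>4 (1 + 2 \<alpha>)\<^sup>2\<close> for \<open>gmat \<alpha>\<close>, hence determines \<open>\<alpha>\<close> up to the reflection
  (\<open>gmat_pairs_separated\<close>). The pair \<open>(T, T)\<close> shares the value 4 with \<open>\<alpha> = 0\<close>, but it
  is the only representative with equal components.
\<close>

section \<open>Two-by-two matrices and conjugation in the special linear group\<close>

lemma mat2_eq_iff:
  fixes A B :: "complex^2^2"
  shows "A = B \<longleftrightarrow> A $ 1 $ 1 = B $ 1 $ 1 \<and> A $ 1 $ 2 = B $ 1 $ 2 \<and>
    A $ 2 $ 1 = B $ 2 $ 1 \<and> A $ 2 $ 2 = B $ 2 $ 2"
  by (auto simp: vec_eq_iff forall_2)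

lemma mat2_mult_nth:
  fixes A B :: "complex^2^2"
  shows "(A ** B) $ i $ j = A $ i $ 1 * B $ 1 $ j + A $ i $ 2 * B $ 2 $ j"
  by (simp add: matrix_matrix_mult_def sum_2)

lemma mat2_one_nth:
  "(mat 1 :: complex^2^2) $ 1 $ 1 = 1" "(mat 1 :: complex^2^2) $ 1 $ 2 = 0"
  "(mat 1 :: complex^2^2) $ 2 $ 1 = 0" "(mat 1 :: complex^2^2) $ 2 $ 2 = 1"
  by (simp_all add: mat_def)

definition mat2 :: "complex \<Rightarrow> complex \<Rightarrow> complex \<Rightarrow> complex \<Rightarrow> complex^2^2"
  where "mat2 a b c d = vector [vector [a, b], vector [c, d]]"

lemma mat2_nth [simp]:
  "mat2 a b c d $ 1 $ 1 = a" "mat2 a b c d $ 1 $ 2 = b"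
  "mat2 a b c d $ 2 $ 1 = c" "mat2 a b c d $ 2 $ 2 = d"
  by (simp_all add: mat2_def)

lemma gmat_eq_mat2: "gmat \<alpha> = mat2 1 \<alpha> 1 (1 + \<alpha>)"
  by (simp add: gmat_def mat2_def)

lemma SL2_sel [simp]:
  "A \<otimes>\<^bsub>SL2\<^esub> B = A ** B" "\<one>\<^bsub>SL2\<^esub> = mat 1"
  by (simp_all add: SL2_def)

lemma in_SL2_iff: "M \<in> carrier SL2 \<longleftrightarrow> M $ 1 $ 1 * M $ 2 $ 2 - M $ 1 $ 2 * M $ 2 $ 1 = 1"
  by (simp add: SL2_def det_2)

lemma SL2_mult_closed [intro]:
  "A \<in> carrier SL2 \<Longrightarrow> B \<in> carrier SL2 \<Longrightarrow> A ** B \<in> carrier SL2"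
  by (simp add: SL2_def det_mul)

lemma gmat_in_SL2 [intro]: "gmat \<alpha> \<in> carrier SL2"
  by (simp add: in_SL2_iff gmat_eq_mat2)

text \<open>
  The adjugate is the inverse on \<^const>\<open>SL2\<close>, but its entries are linear in the matrix; this makes
  the polynomial nature of conjugation visible and reduces identities to ring arithmetic.
\<close>

definition adjugate2 :: "complex^2^2 \<Rightarrow> complex^2^2"
  where "adjugate2 M = mat2 (M $ 2 $ 2) (- M $ 1 $ 2) (- M $ 2 $ 1) (M $ 1 $ 1)"

lemma adjugate2_in_SL2 [intro]: "M \<in> carrier SL2 \<Longrightarrow> adjugate2 M \<in> carrier SL2"
  by (simp add: in_SL2_iff adjugate2_def mult.commute)

lemma adjugate2_mult:
  assumes "M \<in> carrier SL2"
  shows "adjugate2 M ** M = mat 1" "M ** adjugate2 M = mat 1"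
  using assms
  by (auto simp: in_SL2_iff adjugate2_def mat2_eq_iff mat2_mult_nth mat2_one_nth algebra_simps)

lemma inv_SL2_eq_adjugate2: "M \<in> carrier SL2 \<Longrightarrow> inv\<^bsub>SL2\<^esub> M = adjugate2 M"
  by (rule group.inv_equality[OF group_SL2]) (auto simp: adjugate2_mult)

lemma adjugate2_product: "adjugate2 (A ** B) = adjugate2 B ** adjugate2 A"
  by (simp add: mat2_eq_iff adjugate2_def mat2_mult_nth algebra_simps)

definition conj_mat :: "complex^2^2 \<Rightarrow> complex^2^2 \<Rightarrow> complex^2^2"
  where "conj_mat g M = g ** M ** adjugate2 g"

lemma conj_mat_in_SL2 [intro]:
  "g \<in> carrier SL2 \<Longrightarrow> M \<in> carrier SL2 \<Longrightarrow> conj_mat g M \<in> carrier SL2"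
  by (auto simp: conj_mat_def)

lemma conj_mat_conj_mat: "conj_mat g (conj_mat h M) = conj_mat (g ** h) M"
  by (simp add: conj_mat_def adjugate2_product matrix_mul_assoc)

lemma conj_mat_one [simp]: "conj_mat (mat 1) M = M"
proof -
  have "adjugate2 (mat 1) = mat 1"
    by (simp add: mat2_eq_iff adjugate2_def mat2_one_nth)
  then show ?thesis
    by (simp add: conj_mat_def)
qed

lemma conj_mat_cancel [simp]:
  assumes "g \<in> carrier SL2"
  shows "conj_mat g (conj_mat (adjugate2 g) M) = M" "conj_mat (adjugate2 g) (conj_mat g M) = M"
  using assms by (simp_all add: conj_mat_conj_mat adjugate2_mult)

lemma conj_mat_mult:
  assumes "g \<in> carrier SL2"
  shows "conj_mat g (M ** N) = conj_mat g M ** conj_mat g N"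
proof -
  have "conj_mat g M ** conj_mat g N = g ** M ** (adjugate2 g ** g) ** N ** adjugate2 g"
    by (simp only: conj_mat_def matrix_mul_assoc)
  with assms show ?thesis
    by (simp add: adjugate2_mult conj_mat_def matrix_mul_assoc)
qed

lemma trace_conj_mat:
  assumes "g \<in> carrier SL2"
  shows "trace (conj_mat g M) = trace M"
proof -
  have "trace (conj_mat g M) = trace (adjugate2 g ** (g ** M))"
    unfolding conj_mat_def by (rule trace_mul_sym)
  with assms show ?thesis
    by (simp add: matrix_mul_assoc adjugate2_mult)
qed

lemma conj_set_eq_image:
  assumes "g \<in> carrier SL2"
  shows "conj_set g S = conj_mat g ` S"
  using assms
  by (auto simp: conj_set_def l_coset_def r_coset_def inv_SL2_eq_adjugate2 conj_mat_def)

lemma conj_set_conj_set: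
  assumes "g \<in> carrier SL2" "h \<in> carrier SL2"
  shows "conj_set g (conj_set h S) = conj_set (g ** h) S"
  using assms by (simp add: conj_set_eq_image SL2_mult_closed image_image conj_mat_conj_mat)

lemma one_in_SL2 [intro, simp]: "mat 1 \<in> carrier SL2"
  by (simp add: in_SL2_iff mat2_one_nth)

lemma conj_set_one [simp]: "conj_set (mat 1) S = S"
  by (simp add: conj_set_eq_image)

lemma in_conj_set_iff:
  assumes "g \<in> carrier SL2"
  shows "M \<in> conj_set g S \<longleftrightarrow> conj_mat (adjugate2 g) M \<in> S"
  using assms by (force simp: conj_set_eq_image image_iff)

lemma in_diag_torus_iff:
  "M \<in> diag_torus \<longleftrightarrow> M $ 1 $ 1 * M $ 2 $ 2 = 1 \<and> M $ 1 $ 2 = 0 \<and> M $ 2 $ 1 = 0"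
  by (auto simp: diag_torus_def in_SL2_iff)

lemma diag_torus_subset_SL2: "diag_torus \<subseteq> carrier SL2"
  by (auto simp: diag_torus_def)

lemma conj_diag_torus_subset_SL2: "g \<in> carrier SL2 \<Longrightarrow> conj_set g diag_torus \<subseteq> carrier SL2"
  using diag_torus_subset_SL2 by (auto simp: conj_set_eq_image)

lemma in_conj_diag_torus_iff:
  assumes "g \<in> carrier SL2"
  shows "M \<in> conj_set g diag_torus \<longleftrightarrow> M \<in> carrier SL2 \<and>
    conj_mat (adjugate2 g) M $ 1 $ 2 = 0 \<and> conj_mat (adjugate2 g) M $ 2 $ 1 = 0"
proof -
  have "M \<in> carrier SL2 \<longleftrightarrow> conj_mat (adjugate2 g) M \<in> carrier SL2"
    using assms conj_mat_cancel(1) by (metis adjugate2_in_SL2 conj_mat_in_SL2)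
  with assms show ?thesis
    by (simp add: in_conj_set_iff diag_torus_def)
qed

section \<open>Conjugates of the diagonal torus are tori\<close>

text \<open>
  Pullback along a map is an algebra homomorphism, so regularity of a map need only be
  tested on the coordinate functions.
\<close>

lemma alg_generated_pullback:
  assumes gen: "\<And>q. q \<in> X \<Longrightarrow> \<exists>p\<in>alg_generated Y. \<forall>x\<in>V. q (f x) = p x"
    and "q \<in> alg_generated X"
  shows "\<exists>p\<in>alg_generated Y. \<forall>x\<in>V. q (f x) = p x"
  using assms(2)
proof induction
  case (const c)
  then show ?case by (intro bexI[OF _ alg_generated.const]) auto
next
  case (gen q)
  then show ?case by (rule assms(1))
next
  case (add q r)
  then obtain p p' where "p \<in> alg_generated Y" "p' \<in> alg_generated Y"
    and "\<forall>x\<in>V. q (f x) = p x" "\<forall>x\<in>V. r (f x) = p' x" by blast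
  then show ?case
    by (intro bexI[of _ "\<lambda>x. p x + p' x"]) (auto intro: alg_generated.add)
next
  case (mult q r)
  then obtain p p' where "p \<in> alg_generated Y" "p' \<in> alg_generated Y"
    and "\<forall>x\<in>V. q (f x) = p x" "\<forall>x\<in>V. r (f x) = p' x" by blast
  then show ?case
    by (intro bexI[of _ "\<lambda>x. p x * p' x"]) (auto intro: alg_generated.mult)
qed

lemma conj_entry_in_mat_poly_funs: "(\<lambda>M. conj_mat g M $ i $ j) \<in> mat_poly_funs"
proof -
  have entry: "(\<lambda>M. M $ k $ l) \<in> mat_poly_funs" for k l
    unfolding mat_poly_funs_def by (rule alg_generated.gen) auto
  show ?thesis
    unfolding conj_mat_def mat2_mult_nth mat_poly_funs_def
    by (intro alg_generated.add alg_generated.mult alg_generated.const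
        entry[unfolded mat_poly_funs_def])
qed

text \<open>
  The two mutually inverse morphisms between \<open>\<complex>\<^sup>*\<close> and the conjugate of the diagonal torus by \<open>g\<close>.
  The coordinate must be undefined at indices other than 0 to lie in the product group.
\<close>

definition torus_param :: "complex^2^2 \<Rightarrow> (nat \<Rightarrow> complex) \<Rightarrow> complex^2^2"
  where "torus_param g x = conj_mat g (mat2 (x 0) 0 0 (inverse (x 0)))"

definition torus_coord :: "complex^2^2 \<Rightarrow> complex^2^2 \<Rightarrow> (nat \<Rightarrow> complex)"
  where "torus_coord g M = (\<lambda>i\<in>{..<1}. conj_mat (adjugate2 g) M $ 1 $ 1)"

lemma carrier_std_torus: "carrier (std_torus n) = {..<n} \<rightarrow>\<^sub>E (UNIV - {0})"
  by (simp add: std_torus_def product_group_def mult_group_def comp_def)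

lemma mult_std_torus: "x \<otimes>\<^bsub>std_torus n\<^esub> y = (\<lambda>i\<in>{..<n}. x i * y i)"
  by (simp add: std_torus_def product_group_def mult_group_def)

lemma torus_param_coord:
  assumes g: "g \<in> carrier SL2" and M: "M \<in> conj_set g diag_torus"
  shows "torus_coord g M \<in> carrier (std_torus 1)" "torus_param g (torus_coord g M) = M"
    "inverse (torus_coord g M 0) = conj_mat (adjugate2 g) M $ 2 $ 2"
proof -
  define D where "D = conj_mat (adjugate2 g) M"
  have D: "D $ 1 $ 1 * D $ 2 $ 2 = 1" "D $ 1 $ 2 = 0" "D $ 2 $ 1 = 0"
    using M g by (auto simp: in_conj_set_iff in_diag_torus_iff D_def)
  have nz: "D $ 1 $ 1 \<noteq> 0" and inv: "inverse (D $ 1 $ 1) = D $ 2 $ 2"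
    using D(1) by (auto simp: inverse_unique)
  show "torus_coord g M \<in> carrier (std_torus 1)"
    using nz by (auto simp: carrier_std_torus torus_coord_def D_def)
  show "inverse (torus_coord g M 0) = conj_mat (adjugate2 g) M $ 2 $ 2"
    using inv by (simp add: torus_coord_def D_def)
  have "mat2 (D $ 1 $ 1) 0 0 (inverse (D $ 1 $ 1)) = D"
    using D inv by (simp add: mat2_eq_iff)
  then have "torus_param g (torus_coord g M) = conj_mat g D"
    by (simp add: torus_param_def torus_coord_def D_def)
  then show "torus_param g (torus_coord g M) = M"
    using g by (simp add: D_def)
qed

lemma torus_coord_param:
  assumes g: "g \<in> carrier SL2" and x: "x \<in> carrier (std_torus 1)"
  shows "torus_param g x \<in> conj_set g diag_torus" "torus_coord g (torus_param g x) = x"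
proof -
  have "x 0 \<noteq> 0"
    using x by (auto simp: carrier_std_torus PiE_iff)
  then show "torus_param g x \<in> conj_set g diag_torus"
    using g by (simp add: in_conj_set_iff torus_param_def in_diag_torus_iff)
  show "torus_coord g (torus_param g x) = x"
    using g x
    by (auto simp: torus_coord_def torus_param_def fun_eq_iff carrier_std_torus PiE_iff
        extensional_def restrict_def)
qed

lemma subgroup_conj_diag_torus:
  assumes g: "g \<in> carrier SL2"
  shows "subgroup (conj_set g diag_torus) SL2"
proof (rule group.subgroupI[OF group_SL2])
  show "conj_set g diag_torus \<subseteq> carrier SL2"
    using g by (rule conj_diag_torus_subset_SL2)
  have "mat 1 \<in> diag_torus"
    by (simp add: in_diag_torus_iff mat2_one_nth)
  then show "conj_set g diag_torus \<noteq> {}"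
    using g by (auto simp: conj_set_eq_image)
next
  fix M assume "M \<in> conj_set g diag_torus"
  then obtain D where D: "D \<in> diag_torus" "M = conj_mat g D"
    using g by (auto simp: conj_set_eq_image)
  have "adjugate2 M = conj_mat g (adjugate2 D)"
    by (simp add: D(2) conj_mat_def adjugate2_def mat2_eq_iff mat2_mult_nth algebra_simps)
  moreover have "M \<in> carrier SL2"
    using D g diag_torus_subset_SL2 by blast
  moreover have "adjugate2 D \<in> diag_torus"
    using D(1) by (simp add: in_diag_torus_iff adjugate2_def mult.commute)
  ultimately show "inv\<^bsub>SL2\<^esub> M \<in> conj_set g diag_torus"
    using g by (simp add: inv_SL2_eq_adjugate2 conj_set_eq_image)
next
  fix M N assume "M \<in> conj_set g diag_torus" "N \<in> conj_set g diag_torus"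
  then obtain D E where DE: "D \<in> diag_torus" "M = conj_mat g D" "E \<in> diag_torus" "N = conj_mat g E"
    using g by (auto simp: conj_set_eq_image)
  have "D ** E \<in> diag_torus"
    using DE(1,3) diag_torus_subset_SL2 SL2_mult_closed[of D E]
    by (auto simp: diag_torus_def mat2_mult_nth)
  then show "M \<otimes>\<^bsub>SL2\<^esub> N \<in> conj_set g diag_torus"
    using g DE by (simp add: conj_set_eq_image conj_mat_mult[symmetric])
qed

text \<open>
  The entries of the parametrization are linear combinations of the coordinate and its inverse.
  Backwards, the coordinate and its inverse are the two diagonal entries of the matrix conjugated
  back, hence polynomial in the matrix. The vanishing of the other two entries is the closed
  condition defining the torus.
\<close>

lemma is_torus_conj_diag_torus:
  assumes g: "g \<in> carrier SL2"
  shows "is_torus (conj_set g diag_torus)"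
proof -
  let ?S = "conj_set g diag_torus"
  let ?\<phi> = "torus_param g"
  let ?T = "std_torus 1"
  let ?P = "{\<lambda>M. conj_mat (adjugate2 g) M $ 1 $ 2, \<lambda>M. conj_mat (adjugate2 g) M $ 2 $ 1}"
  have closed: "closed_in_SL2 ?S"
    unfolding closed_in_SL2_def
  proof (intro exI conjI)
    show "?P \<subseteq> mat_poly_funs"
      by (auto intro: conj_entry_in_mat_poly_funs)
    show "?S = {M \<in> carrier SL2. \<forall>p\<in>?P. p M = 0}"
      using in_conj_diag_torus_iff[OF g] by auto
  qed
  have bij: "bij_betw ?\<phi> (carrier ?T) ?S"
    by (rule bij_betw_byWitness[where f' = "torus_coord g"])
      (auto simp only: torus_param_coord[OF g] torus_coord_param[OF g])
  have "?\<phi> (x \<otimes>\<^bsub>?T\<^esub> y) = ?\<phi> x ** ?\<phi> y" for x y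
  proof -
    have "mat2 (x 0 * y 0) 0 0 (inverse (x 0 * y 0)) =
        mat2 (x 0) 0 0 (inverse (x 0)) ** mat2 (y 0) 0 0 (inverse (y 0))"
      by (simp add: mat2_eq_iff mat2_mult_nth)
    then show ?thesis
      using g by (simp add: torus_param_def mult_std_torus conj_mat_mult[symmetric])
  qed
  then have iso: "?\<phi> \<in> iso ?T (SL2\<lparr>carrier := ?S\<rparr>)"
    using bij by (auto simp: iso_def hom_def torus_coord_param[OF g])
  have x0: "(\<lambda>x. x 0) \<in> laurent_funs 1"
    unfolding laurent_funs_def by (rule alg_generated.gen) auto
  have ix0: "(\<lambda>x. inverse (x 0)) \<in> laurent_funs 1"
    unfolding laurent_funs_def by (rule alg_generated.gen) auto
  have mor: "variety_morphism (carrier ?T) (laurent_funs 1) ?S mat_poly_funs ?\<phi>"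
    unfolding variety_morphism_def
  proof (intro conjI ballI)
    show "?\<phi> \<in> carrier ?T \<rightarrow> ?S"
      by (auto simp: torus_coord_param[OF g])
    fix q assume q: "q \<in> mat_poly_funs"
    have "\<exists>p\<in>laurent_funs 1. \<forall>x\<in>carrier ?T. ?\<phi> x $ i $ j = p x" for i j
    proof
      let ?p = "\<lambda>x :: nat \<Rightarrow> complex. g $ i $ 1 * x 0 * adjugate2 g $ 1 $ j +
        g $ i $ 2 * inverse (x 0) * adjugate2 g $ 2 $ j"
      show "?p \<in> laurent_funs 1"
        unfolding laurent_funs_def
        by (intro alg_generated.add alg_generated.mult alg_generated.const
            x0[unfolded laurent_funs_def] ix0[unfolded laurent_funs_def])
      show "\<forall>x\<in>carrier ?T. ?\<phi> x $ i $ j = ?p x"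
        by (simp add: torus_param_def conj_mat_def mat2_mult_nth)
    qed
    then show "\<exists>p\<in>laurent_funs 1. \<forall>x\<in>carrier ?T. q (?\<phi> x) = p x"
      unfolding laurent_funs_def
      by (intro alg_generated_pullback[OF _ q[unfolded mat_poly_funs_def]]) blast
  qed
  have inv: "inv_into (carrier ?T) ?\<phi> M = torus_coord g M" if "M \<in> ?S" for M
    using that bij torus_param_coord[OF g that]
    by (metis bij_betw_imp_inj_on inv_into_f_f)
  have mor': "variety_morphism ?S mat_poly_funs (carrier ?T) (laurent_funs 1)
      (inv_into (carrier ?T) ?\<phi>)"
    unfolding variety_morphism_def
  proof (intro conjI ballI)
    show "inv_into (carrier ?T) ?\<phi> \<in> ?S \<rightarrow> carrier ?T"
      using inv torus_param_coord(1)[OF g] by auto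
    fix q assume q: "q \<in> laurent_funs 1"
    have "\<exists>p\<in>mat_poly_funs. \<forall>M\<in>?S. r (inv_into (carrier ?T) ?\<phi> M) = p M"
      if "r \<in> {\<lambda>x. x i | i. i < 1} \<union> {\<lambda>x. inverse (x i) | i. i < (1::nat)}" for r
    proof -
      consider "r = (\<lambda>x. x 0)" | "r = (\<lambda>x. inverse (x 0))"
        using \<open>r \<in> _\<close> by auto
      then show ?thesis
      proof cases
        case 1
        then show ?thesis
          using inv
          by (intro bexI[OF _ conj_entry_in_mat_poly_funs[of "adjugate2 g" 1 1]])
            (auto simp: torus_coord_def)
      next
        case 2
        then show ?thesis
          using inv torus_param_coord(3)[OF g]
          by (intro bexI[OF _ conj_entry_in_mat_poly_funs[of "adjugate2 g" 2 2]]) auto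
      qed
    qed
    then show "\<exists>p\<in>mat_poly_funs. \<forall>M\<in>?S. q (inv_into (carrier ?T) ?\<phi> M) = p M"
      unfolding mat_poly_funs_def
      by (intro alg_generated_pullback[OF _ q[unfolded laurent_funs_def]])
  qed
  show ?thesis
    unfolding is_torus_def
    using subgroup_conj_diag_torus[OF g] closed iso mor mor' by blast
qed

section \<open>Every torus lies in a conjugate of the diagonal torus\<close>

lemma polynomial_function_on_line:
  fixes A B :: "complex^2^2"
  assumes "p \<in> mat_poly_funs"
  shows "\<exists>P. \<forall>t. p (\<chi> i j. A $ i $ j + t * B $ i $ j) = poly P t"
proof -
  have "p \<in> alg_generated {\<lambda>M. M $ i $ j | i j. True}"
    using assms by (simp add: mat_poly_funs_def)
  then show ?thesis
  proof induction
    case (const c)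
    show ?case by (rule exI[of _ "[:c:]"]) simp
  next
    case (gen f)
    then obtain i j where f: "f = (\<lambda>M. M $ i $ j)" by auto
    show ?case by (rule exI[of _ "[:A $ i $ j, B $ i $ j:]"]) (simp add: f)
  next
    case (add f h)
    then obtain P Q where "\<forall>t. f (\<chi> i j. A $ i $ j + t * B $ i $ j) = poly P t"
      "\<forall>t. h (\<chi> i j. A $ i $ j + t * B $ i $ j) = poly Q t" by blast
    then show ?case by (intro exI[of _ "P + Q"]) simp
  next
    case (mult f h)
    then obtain P Q where "\<forall>t. f (\<chi> i j. A $ i $ j + t * B $ i $ j) = poly P t"
      "\<forall>t. h (\<chi> i j. A $ i $ j + t * B $ i $ j) = poly Q t" by blast
    then show ?case by (intro exI[of _ "P * Q"]) simp
  qed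
qed

text \<open>
  The product \<open>P Q\<close> takes the value 1 at all naturals, so it is the constant 1 and \<open>P\<close> is constant.
\<close>

lemma polynomial_geometric_sequence_trivial:
  fixes c :: complex
  assumes P: "\<And>k. poly P (of_nat k) = c ^ k" and Q: "\<And>k. poly Q (of_nat k) = inverse (c ^ k)"
    and "c \<noteq> 0"
  shows "c = 1"
proof -
  have "range of_nat \<subseteq> {t. poly (P * Q - 1) t = 0}"
    using assms by (auto simp: field_simps)
  moreover have "infinite (range (of_nat :: nat \<Rightarrow> complex))"
    by (simp add: inj_of_nat finite_image_iff)
  ultimately have "P * Q - 1 = 0"
    using poly_roots_finite infinite_super by blast
  then have "P * Q = 1" by simp
  then have "P \<noteq> 0" "Q \<noteq> 0" "degree (P * Q) = 0" by auto
  then have "degree P = 0"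
    by (simp add: degree_mult_eq)
  then obtain a where "P = [:a:]"
    by (rule degree_eq_zeroE)
  then show ?thesis
    using P[of 1] P[of 0] by simp
qed

text \<open>
  If \<open>M = 1 + E\<close> has trace 2, then \<open>E\<^sup>2 = 0\<close>, so the powers \<open>M\<^sup>k = 1 + k E\<close> lie on a line.
  A coordinate of \<open>(\<complex>\<^sup>*)\<^sup>n\<close> and its inverse pull back to polynomials on this line, and at \<open>M\<^sup>k\<close> they
  are the \<open>k\<close>-th powers of their values at \<open>M\<close>. Hence all coordinates of \<open>M\<close> are 1.
\<close>

lemma torus_unipotent_eq_one:
  assumes S: "is_torus S" and M: "M \<in> S" and tr: "trace M = 2"
  shows "M = mat 1"
proof -
  obtain n \<phi> where \<phi>: "\<phi> \<in> iso (std_torus n) (SL2\<lparr>carrier := S\<rparr>)"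
    and mor: "variety_morphism S mat_poly_funs (carrier (std_torus n)) (laurent_funs n)
         (inv_into (carrier (std_torus n)) \<phi>)"
    and sub: "subgroup S SL2"
    using S unfolding is_torus_def by blast
  let ?T = "carrier (std_torus n)"
  let ?\<psi> = "inv_into ?T \<phi>"
  have inj: "inj_on \<phi> ?T" and im: "\<phi> ` ?T = S"
    and hom: "\<And>x y. x \<in> ?T \<Longrightarrow> y \<in> ?T \<Longrightarrow> \<phi> (x \<otimes>\<^bsub>std_torus n\<^esub> y) = \<phi> x ** \<phi> y"
    using \<phi> by (auto simp: iso_def bij_betw_def hom_def)
  define x where "x = ?\<psi> M"
  have xT: "x \<in> ?T" and \<phi>x: "\<phi> x = M"
    using M im by (auto simp: x_def inv_into_into f_inv_into_f)
  have xnz: "x i \<noteq> 0" if "i < n" for i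
    using xT that by (auto simp: carrier_std_torus PiE_iff)
  define xp where "xp k = (\<lambda>i\<in>{..<n}. x i ^ k)" for k :: nat
  have xpT: "xp k \<in> ?T" for k
    using xnz by (auto simp: xp_def carrier_std_torus)
  define line where "line t = (\<chi> i j. (mat 1 :: complex^2^2) $ i $ j + t * (M - mat 1) $ i $ j)"
    for t
  have MSL: "M \<in> carrier SL2"
    using sub M subgroup.subset by blast
  \<comment> \<open>Cayley-Hamilton for the characteristic polynomial \<open>(X - 1)\<^sup>2\<close>.\<close>
  have nilp: "(M - mat 1) ** (M - mat 1) = 0"
  proof -
    have d: "M $ 2 $ 2 = 2 - M $ 1 $ 1"
      using tr by (simp add: trace_def sum_2 algebra_simps)
    with MSL have "M $ 1 $ 2 * M $ 2 $ 1 = M $ 1 $ 1 * (2 - M $ 1 $ 1) - 1"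
      by (simp add: in_SL2_iff algebra_simps)
    then show ?thesis
      by (simp add: mat2_eq_iff mat2_mult_nth mat2_one_nth d algebra_simps)
  qed
  \<comment> \<open>An idempotent element of a group is the identity.\<close>
  have one: "\<phi> (xp 0) = mat 1"
  proof -
    have "\<phi> (xp 0) ** \<phi> (xp 0) = \<phi> (xp 0)"
      using hom[OF xpT xpT, of 0 0] by (simp add: mult_std_torus xp_def cong: restrict_cong)
    moreover have "\<phi> (xp 0) \<in> carrier SL2"
      using xpT im sub subgroup.subset by blast
    ultimately show ?thesis
      by (metis adjugate2_mult(1) matrix_mul_assoc matrix_mul_lid)
  qed
  have line: "\<phi> (xp k) = line (of_nat k)" for k
  proof (induction k)
    case 0
    then show ?case by (simp add: one line_def vec_eq_iff)
  next
    case (Suc k)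
    have "xp (Suc k) = xp k \<otimes>\<^bsub>std_torus n\<^esub> x"
      by (auto simp: xp_def mult_std_torus fun_eq_iff)
    then have "\<phi> (xp (Suc k)) = line (of_nat k) ** M"
      using hom[OF xpT xT] Suc \<phi>x by simp
    also have "\<dots> = line (of_nat (Suc k))"
      using nilp by (simp add: mat2_eq_iff mat2_mult_nth mat2_one_nth line_def algebra_simps) algebra
    finally show ?case .
  qed
  have \<psi>line: "?\<psi> (line (of_nat k)) = xp k" for k
    using inj xpT by (metis line inv_into_f_f)
  have lineS: "line (of_nat k) \<in> S" for k
    using im xpT line by (metis imageI)
  have "x i = 1" if i: "i < n" for i
  proof -
    have pullback: "\<exists>p\<in>mat_poly_funs. \<forall>M\<in>S. q (?\<psi> M) = p M" if "q \<in> laurent_funs n" for q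
      using mor that by (auto simp: variety_morphism_def)
    have "(\<lambda>x. x i) \<in> laurent_funs n" "(\<lambda>x. inverse (x i)) \<in> laurent_funs n"
      using i unfolding laurent_funs_def by (auto intro!: alg_generated.gen)
    then obtain p q where pq: "p \<in> mat_poly_funs" "q \<in> mat_poly_funs"
      "\<And>M. M \<in> S \<Longrightarrow> ?\<psi> M i = p M" "\<And>M. M \<in> S \<Longrightarrow> inverse (?\<psi> M i) = q M"
      using pullback[of "\<lambda>x. x i"] pullback[of "\<lambda>x. inverse (x i)"] by auto
    obtain P where P: "\<forall>t. p (line t) = poly P t"
      using polynomial_function_on_line[OF pq(1)] unfolding line_def by blast
    obtain Q where Q: "\<forall>t. q (line t) = poly Q t"
      using polynomial_function_on_line[OF pq(2)] unfolding line_def by blast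
    have "poly P (of_nat k) = x i ^ k" for k
      using P pq(3)[OF lineS, of k] i by (simp add: \<psi>line xp_def)
    moreover have "poly Q (of_nat k) = inverse (x i ^ k)" for k
      using Q pq(4)[OF lineS, of k] i by (simp add: \<psi>line xp_def)
    ultimately show ?thesis
      using xnz[OF i] by (rule polynomial_geometric_sequence_trivial)
  qed
  then have "x = xp 0"
    using xT by (auto simp: xp_def carrier_std_torus PiE_iff extensional_def fun_eq_iff)
  then show ?thesis
    using \<phi>x one by simp
qed

lemma torus_subset_SL2: "is_torus S \<Longrightarrow> S \<subseteq> carrier SL2"
  by (simp add: is_torus_def subgroup.subset)

lemma torus_commute:
  assumes S: "is_torus S" and "M \<in> S" "N \<in> S"
  shows "M ** N = N ** M"
proof -
  obtain n \<phi> where \<phi>: "\<phi> \<in> iso (std_torus n) (SL2\<lparr>carrier := S\<rparr>)"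
    using S unfolding is_torus_def by blast
  then have im: "\<phi> ` carrier (std_torus n) = S"
    and hom: "\<And>x y. x \<in> carrier (std_torus n) \<Longrightarrow> y \<in> carrier (std_torus n) \<Longrightarrow>
      \<phi> (x \<otimes>\<^bsub>std_torus n\<^esub> y) = \<phi> x ** \<phi> y"
    by (auto simp: iso_def bij_betw_def hom_def)
  obtain x y where xy: "x \<in> carrier (std_torus n)" "y \<in> carrier (std_torus n)" "M = \<phi> x" "N = \<phi> y"
    using im assms by blast
  have "x \<otimes>\<^bsub>std_torus n\<^esub> y = y \<otimes>\<^bsub>std_torus n\<^esub> x"
    by (simp add: mult_std_torus mult.commute)
  then show ?thesis
    using hom xy by metis
qed

text \<open>
  The square of \<open>M\<close> is unipotent, so \<open>M\<^sup>2 = 1\<close>. The off-diagonal entries of \<open>M\<^sup>2\<close> are those of \<open>M\<close>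
  times the nonzero trace.
\<close>

lemma torus_nonregular_scalar:
  assumes S: "is_torus S" and M: "M \<in> S" and tr: "(trace M)\<^sup>2 = 4"
  shows "M \<in> diag_torus"
proof -
  have MSL: "M \<in> carrier SL2"
    using torus_subset_SL2[OF S] M by blast
  have "trace (M ** M) = (trace M)\<^sup>2 - 2"
    using MSL by (simp add: trace_def sum_2 mat2_mult_nth in_SL2_iff power2_eq_square algebra_simps)
  moreover have "M ** M \<in> S"
    using S M subgroup.m_closed[of S SL2] by (auto simp: is_torus_def)
  ultimately have "M ** M = mat 1"
    using torus_unipotent_eq_one[OF S] tr by simp
  then have "M $ 1 $ 2 * trace M = 0" "M $ 2 $ 1 * trace M = 0"
    by (auto simp: mat2_eq_iff mat2_mult_nth mat2_one_nth trace_def sum_2 algebra_simps)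
  moreover have "trace M \<noteq> 0"
    using tr by auto
  ultimately show ?thesis
    using MSL by (simp add: diag_torus_def)
qed

lemma regular_diagonalizable:
  assumes M: "M \<in> carrier SL2" and tr: "(trace M)\<^sup>2 \<noteq> 4"
  shows "\<exists>g\<in>carrier SL2. M \<in> conj_set g diag_torus"
proof -
  obtain a b c d where abcd: "a = M $ 1 $ 1" "b = M $ 1 $ 2" "c = M $ 2 $ 1" "d = M $ 2 $ 2"
    by blast
  have det: "a * d - b * c = 1"
    using M by (simp add: in_SL2_iff abcd)
  have disc: "(a + d)\<^sup>2 \<noteq> 4"
    using tr by (simp add: trace_def sum_2 abcd)
  define s where "s = csqrt ((a + d)\<^sup>2 - 4)"
  have s: "s * s = (a + d) * (a + d) - 4"
    using power2_csqrt[of "(a + d)\<^sup>2 - 4"] by (simp add: s_def power2_eq_square)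
  have snz: "s \<noteq> 0"
    using disc by (simp add: s_def)
  show ?thesis
  proof (cases "b = 0")
    case True
    then have ad: "a * d = 1" using det by simp
    have ne: "a - d \<noteq> 0"
    proof
      assume "a - d = 0"
      then have "(a + d)\<^sup>2 = 4 * (a * d)" by (simp add: power2_eq_square)
      with ad disc show False by simp
    qed
    \<comment> \<open>The columns are eigenvectors for \<open>a\<close> and \<open>d\<close>, scaled to determinant 1.\<close>
    let ?g = "mat2 (a - d) 0 c (1 / (a - d))"
    have g: "?g \<in> carrier SL2"
      using ne by (simp add: in_SL2_iff)
    have "conj_mat (adjugate2 ?g) M $ 1 $ 2 = 0" "conj_mat (adjugate2 ?g) M $ 2 $ 1 = 0"
      using ne True
      by (simp_all add: conj_mat_def mat2_mult_nth adjugate2_def abcd[symmetric] field_simps)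
    then show ?thesis
      using in_conj_diag_torus_iff[OF g] M g by blast
  next
    case False
    \<comment> \<open>The columns are eigenvectors \<open>(b, \<lambda> - a)\<close> for the eigenvalues \<open>\<lambda> = (a + d \<plusminus> s) / 2\<close>,
      the second one divided by \<open>- b s\<close> to make the determinant 1.\<close>
    let ?g = "mat2 b (- 1 / s) ((d - a + s) / 2) (- ((d - a - s) / (2 * b * s)))"
    have g: "?g \<in> carrier SL2"
      using False snz by (simp add: in_SL2_iff field_simps)
    have "conj_mat (adjugate2 ?g) M $ 1 $ 2 = 0"
      using False snz det s
      apply (simp add: conj_mat_def mat2_mult_nth adjugate2_def abcd[symmetric] field_simps)
      by algebra
    moreover have "conj_mat (adjugate2 ?g) M $ 2 $ 1 = 0"
      using False snz det s
      apply (simp add: conj_mat_def mat2_mult_nth adjugate2_def abcd[symmetric] field_simps)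
      by algebra
    ultimately show ?thesis
      using in_conj_diag_torus_iff[OF g] M g by blast
  qed
qed

lemma centralizer_of_regular_element:
  assumes g: "g \<in> carrier SL2" and M: "M \<in> conj_set g diag_torus" and tr: "(trace M)\<^sup>2 \<noteq> 4"
    and N: "N \<in> carrier SL2" and comm: "M ** N = N ** M"
  shows "N \<in> conj_set g diag_torus"
proof -
  let ?h = "adjugate2 g"
  have h: "?h \<in> carrier SL2"
    using g by blast
  define D E where "D = conj_mat ?h M" and "E = conj_mat ?h N"
  have D: "D $ 1 $ 1 * D $ 2 $ 2 = 1" "D $ 1 $ 2 = 0" "D $ 2 $ 1 = 0"
    using M g by (auto simp: in_conj_set_iff in_diag_torus_iff D_def)
  have "trace D = trace M"
    using trace_conj_mat[OF h] by (simp add: D_def)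
  then have "(D $ 1 $ 1 + D $ 2 $ 2)\<^sup>2 \<noteq> 4"
    using tr by (simp add: trace_def sum_2)
  with D(1) have ne: "D $ 1 $ 1 \<noteq> D $ 2 $ 2"
    by (auto simp: power2_eq_square algebra_simps)
  have "D ** E = E ** D"
    using comm conj_mat_mult[OF h] by (metis D_def E_def)
  then have "E $ 1 $ 2 = 0" "E $ 2 $ 1 = 0"
    using ne by (auto simp: mat2_eq_iff mat2_mult_nth D)
  then show ?thesis
    using N in_conj_diag_torus_iff[OF g] by (auto simp: E_def)
qed

lemma torus_subset_conj_diag_torus:
  assumes S: "is_torus S"
  shows "\<exists>g\<in>carrier SL2. S \<subseteq> conj_set g diag_torus"
proof (cases "\<exists>M\<in>S. (trace M)\<^sup>2 \<noteq> 4")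
  case True
  then obtain M where M: "M \<in> S" "(trace M)\<^sup>2 \<noteq> 4" by blast
  then obtain g where g: "g \<in> carrier SL2" "M \<in> conj_set g diag_torus"
    using regular_diagonalizable torus_subset_SL2[OF S] by blast
  have "S \<subseteq> conj_set g diag_torus"
    using centralizer_of_regular_element[OF g M(2)] torus_commute[OF S M(1)] torus_subset_SL2[OF S]
    by blast
  with g(1) show ?thesis by blast
next
  case False
  then have "S \<subseteq> conj_set (mat 1) diag_torus"
    using torus_nonregular_scalar[OF S] by auto
  then show ?thesis by blast
qed

text \<open>
  For the maximality of a conjugate of the diagonal torus, note that it contains a regular element;
  a larger torus would commute with that element and so lie in its centralizer.
\<close>

theorem maximal_torus_iff_conj_diag_torus:
  "maximal_torus S \<longleftrightarrow> (\<exists>g\<in>carrier SL2. S = conj_set g diag_torus)"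
proof
  assume max: "maximal_torus S"
  then obtain g where g: "g \<in> carrier SL2" "S \<subseteq> conj_set g diag_torus"
    using torus_subset_conj_diag_torus unfolding maximal_torus_def by blast
  with max is_torus_conj_diag_torus[OF g(1)] show "\<exists>g\<in>carrier SL2. S = conj_set g diag_torus"
    by (auto simp: maximal_torus_def)
next
  assume "\<exists>g\<in>carrier SL2. S = conj_set g diag_torus"
  then obtain g where g: "g \<in> carrier SL2" and S: "S = conj_set g diag_torus"
    by blast
  define M where "M = conj_mat g (mat2 2 0 0 (1 / 2))"
  have M: "M \<in> S"
    using g by (simp add: S M_def conj_set_eq_image in_diag_torus_iff)
  have tr: "(trace M)\<^sup>2 \<noteq> 4"
    unfolding M_def trace_conj_mat[OF g] by (simp add: trace_def sum_2 power2_eq_square)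
  have "S' = S" if S': "is_torus S'" "S \<subseteq> S'" for S'
  proof
    show "S' \<subseteq> S"
    proof
      fix N assume N: "N \<in> S'"
      have "M ** N = N ** M"
        using S'(2) M N by (intro torus_commute[OF S'(1)]) auto
      moreover have "N \<in> carrier SL2"
        using N torus_subset_SL2[OF S'(1)] by blast
      ultimately show "N \<in> S"
        using centralizer_of_regular_element[OF g M[unfolded S] tr] by (simp add: S)
    qed
  qed (rule S'(2))
  then show "maximal_torus S"
    using is_torus_conj_diag_torus[OF g] by (simp add: maximal_torus_def S)
qed

section \<open>Normal forms for pairs of maximal tori\<close>

lemma conj_diag_torus_absorb:
  assumes g: "g \<in> carrier SL2" and n: "n \<in> carrier SL2" and T: "conj_set n diag_torus = diag_torus"
  shows "conj_set (g ** n) diag_torus = conj_set g diag_torus"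
  using conj_set_conj_set[OF g n] T by metis

definition weyl :: "complex^2^2"
  where "weyl = mat2 0 1 (- 1) 0"

lemma weyl_in_SL2 [intro]: "weyl \<in> carrier SL2"
  by (simp add: weyl_def in_SL2_iff)

lemma conj_set_weyl: "conj_set weyl diag_torus = diag_torus"
  unfolding set_eq_iff in_conj_set_iff[OF weyl_in_SL2]
  by (auto simp: in_diag_torus_iff conj_mat_def mat2_mult_nth weyl_def adjugate2_def mult.commute)

lemma conj_set_diagonal:
  assumes "u \<noteq> 0"
  shows "mat2 u 0 0 (1 / u) \<in> carrier SL2" "conj_set (mat2 u 0 0 (1 / u)) diag_torus = diag_torus"
proof -
  show D: "mat2 u 0 0 (1 / u) \<in> carrier SL2"
    using assms by (simp add: in_SL2_iff)
  show "conj_set (mat2 u 0 0 (1 / u)) diag_torus = diag_torus"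
    using assms
    by (auto simp: in_conj_set_iff[OF D] in_diag_torus_iff conj_mat_def mat2_mult_nth adjugate2_def)
qed

text \<open>
  Multiplying \<open>k\<close> by \<open>diag(u, 1/u)\<close> on the left and by \<open>diag(s, 1/s)\<close> on the right makes the first
  column \<open>(u a s, c s / u)\<close>, which is \<open>(1, 1)\<close> for \<open>s\<^sup>2 = 1 / (a c)\<close> and \<open>u = c s\<close>. The product of
  the off-diagonal entries does not change.
\<close>

lemma pair_conj_to_gmat:
  assumes k: "k \<in> carrier SL2" and nz: "k $ 1 $ 1 \<noteq> 0" "k $ 2 $ 1 \<noteq> 0"
  shows "\<exists>g\<in>carrier SL2. conj_pair g (conj_set k diag_torus, diag_torus) =
    (conj_set (gmat (k $ 1 $ 2 * k $ 2 $ 1)) diag_torus, diag_torus)"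
proof -
  obtain a b c d where abcd: "a = k $ 1 $ 1" "b = k $ 1 $ 2" "c = k $ 2 $ 1" "d = k $ 2 $ 2"
    by blast
  define s where "s = 1 / csqrt (a * c)"
  have ac: "a \<noteq> 0" "c \<noteq> 0"
    using nz by (simp_all add: abcd)
  have s: "s * s * a * c = 1" "s \<noteq> 0"
    using ac power2_csqrt[of "a * c"] by (simp_all add: s_def power2_eq_square field_simps)
  define u where "u = c * s"
  have u: "u \<noteq> 0" "u * a * s = 1"
    using s ac by (simp_all add: u_def algebra_simps)
  let ?D = "mat2 u 0 0 (1 / u)"
  let ?E = "mat2 s 0 0 (1 / s)"
  have det: "a * d = 1 + b * c"
    using k by (simp add: in_SL2_iff abcd algebra_simps)
  \<comment> \<open>This puts \<open>(1 + b c) / (a c) = d / c\<close> into the form free of denominators in which the last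
    entry of the product below is compared.\<close>
  have "d = (a * d) * (c * s * s)"
    using s(1) by algebra
  then have "d = c * (s * s) + b * (c * (c * (s * s)))"
    by (simp add: det algebra_simps)
  then have "?D ** k ** ?E = gmat (b * c)"
    using u s
    by (simp add: mat2_eq_iff mat2_mult_nth gmat_eq_mat2 abcd[symmetric] u_def field_simps)
  moreover have "conj_set (?D ** k ** ?E) diag_torus = conj_set ?D (conj_set k diag_torus)"
    using conj_diag_torus_absorb[OF _ conj_set_diagonal[OF s(2)], of "?D ** k"]
      conj_set_conj_set[OF conj_set_diagonal(1)[OF u(1)] k] conj_set_diagonal(1)[OF u(1)] k
    by (simp add: SL2_mult_closed)
  ultimately show ?thesis
    using conj_set_diagonal[OF u(1)]
    by (intro bexI[of _ ?D]) (simp_all add: conj_pair_def abcd)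
qed

lemma param_region_iff:
  "\<alpha> \<in> param_region \<longleftrightarrow> Re \<alpha> > - 1 / 2 \<or> (Re \<alpha> = - 1 / 2 \<and> Im \<alpha> \<ge> 0)"
  by (cases \<alpha>) (auto simp: param_region_def)

lemma param_region_cover: "\<alpha> \<in> param_region \<or> - 1 - \<alpha> \<in> param_region"
  by (auto simp: param_region_iff)

lemma param_region_separates:
  assumes "\<alpha> \<in> param_region" "\<beta> \<in> param_region" and eq: "(1 + 2 * \<alpha>)\<^sup>2 = (1 + 2 * \<beta>)\<^sup>2"
  shows "\<alpha> = \<beta>"
proof -
  have "1 + 2 * \<alpha> = 1 + 2 * \<beta> \<or> 1 + 2 * \<alpha> = - (1 + 2 * \<beta>)"
    using eq by (simp add: power2_eq_iff)
  then show ?thesis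
  proof
    assume *: "1 + 2 * \<alpha> = - (1 + 2 * \<beta>)"
    then have "1 + 2 * Re \<alpha> = - (1 + 2 * Re \<beta>)" "2 * Im \<alpha> = - (2 * Im \<beta>)"
      by (simp_all add: complex_eq_iff)
    with assms(1,2) have "Re \<alpha> = Re \<beta>" "Im \<alpha> = Im \<beta>"
      by (auto simp: param_region_iff)
    then show ?thesis by (simp add: complex_eq_iff)
  qed simp
qed

lemma conj_pair_conj_pair:
  assumes "g \<in> carrier SL2" "h \<in> carrier SL2"
  shows "conj_pair g (conj_pair h p) = conj_pair (g ** h) p"
  using assms by (cases p) (simp add: conj_pair_def conj_set_conj_set)

text \<open>
  Exchanging the rows of \<open>k\<close> by a Weyl element fixes the second torus and replaces the parameter
  \<open>b c\<close> by \<open>- a d = - 1 - b c\<close>, its reflection about \<open>-1/2\<close>.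
\<close>

lemma pair_conj_to_param_region:
  assumes k: "k \<in> carrier SL2" and nz: "k $ 1 $ 1 \<noteq> 0" "k $ 2 $ 1 \<noteq> 0"
  shows "\<exists>g\<in>carrier SL2. \<exists>\<alpha>\<in>param_region. conj_pair g (conj_set k diag_torus, diag_torus) =
    (conj_set (gmat \<alpha>) diag_torus, diag_torus)"
proof (cases "k $ 1 $ 2 * k $ 2 $ 1 \<in> param_region")
  case True
  with pair_conj_to_gmat[OF k nz] show ?thesis by blast
next
  case False
  have w: "weyl ** k \<in> carrier SL2"
    using k by blast
  have "(weyl ** k) $ 1 $ 2 * (weyl ** k) $ 2 $ 1 = - 1 - k $ 1 $ 2 * k $ 2 $ 1"
    using k by (simp add: weyl_def mat2_mult_nth in_SL2_iff algebra_simps)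
  then have "(weyl ** k) $ 1 $ 2 * (weyl ** k) $ 2 $ 1 \<in> param_region"
    using False param_region_cover by metis
  moreover obtain g where g: "g \<in> carrier SL2"
    "conj_pair g (conj_set (weyl ** k) diag_torus, diag_torus) =
      (conj_set (gmat ((weyl ** k) $ 1 $ 2 * (weyl ** k) $ 2 $ 1)) diag_torus, diag_torus)"
    using pair_conj_to_gmat[OF w] nz by (auto simp: weyl_def mat2_mult_nth)
  moreover have "conj_pair weyl (conj_set k diag_torus, diag_torus) =
      (conj_set (weyl ** k) diag_torus, diag_torus)"
    using k by (simp add: conj_pair_def conj_set_conj_set weyl_in_SL2 conj_set_weyl)
  ultimately show ?thesis
    using conj_pair_conj_pair[OF g(1) weyl_in_SL2] SL2_mult_closed[OF g(1) weyl_in_SL2] by metis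
qed

text \<open>
  Exchanging the columns of \<open>k\<close> does not change the torus it defines, so either column may serve as
  the one without zero entry. If both columns contain a zero, then \<open>k\<close> is diagonal or antidiagonal.
\<close>

lemma relative_position_normal_form:
  assumes k: "k \<in> carrier SL2"
  shows "conj_set k diag_torus = diag_torus \<or>
    (\<exists>g\<in>carrier SL2. \<exists>\<alpha>\<in>param_region. conj_pair g (conj_set k diag_torus, diag_torus) =
      (conj_set (gmat \<alpha>) diag_torus, diag_torus))"
proof -
  have det: "k $ 1 $ 1 * k $ 2 $ 2 - k $ 1 $ 2 * k $ 2 $ 1 = 1"
    using k by (simp add: in_SL2_iff)
  consider "k $ 1 $ 1 \<noteq> 0 \<and> k $ 2 $ 1 \<noteq> 0" | "k $ 1 $ 2 \<noteq> 0 \<and> k $ 2 $ 2 \<noteq> 0"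
    | "k $ 1 $ 2 = 0 \<and> k $ 2 $ 1 = 0" | "k $ 1 $ 1 = 0 \<and> k $ 2 $ 2 = 0"
    using det by fastforce
  then show ?thesis
  proof cases
    case 1
    then show ?thesis using pair_conj_to_param_region[OF k] by blast
  next
    case 2
    have "k ** weyl \<in> carrier SL2" using k by blast
    moreover have "(k ** weyl) $ 1 $ 1 \<noteq> 0" "(k ** weyl) $ 2 $ 1 \<noteq> 0"
      using 2 by (simp_all add: weyl_def mat2_mult_nth)
    ultimately show ?thesis
      using pair_conj_to_param_region conj_diag_torus_absorb[OF k weyl_in_SL2 conj_set_weyl]
      by metis
  next
    case 3
    have "k $ 1 $ 1 \<noteq> 0"
      using det 3 by auto
    moreover from this have "k $ 2 $ 2 = 1 / k $ 1 $ 1"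
      using det 3 by (simp add: field_simps)
    ultimately have "k = mat2 (k $ 1 $ 1) 0 0 (1 / k $ 1 $ 1)"
      using 3 by (simp add: mat2_eq_iff)
    with conj_set_diagonal(2) \<open>k $ 1 $ 1 \<noteq> 0\<close> show ?thesis by metis
  next
    case 4
    have "k $ 1 $ 2 \<noteq> 0"
      using det 4 by auto
    moreover from this have "k $ 2 $ 1 = - 1 / k $ 1 $ 2"
      using det 4 by (simp add: field_simps minus_equation_iff)
    ultimately have "k = mat2 (k $ 1 $ 2) 0 0 (1 / k $ 1 $ 2) ** weyl"
      using 4 by (simp add: mat2_eq_iff mat2_mult_nth weyl_def)
    with conj_set_diagonal \<open>k $ 1 $ 2 \<noteq> 0\<close> conj_diag_torus_absorb weyl_in_SL2 conj_set_weyl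
    show ?thesis by metis
  qed
qed

lemma pair_normal_form:
  assumes "maximal_torus S1" "maximal_torus S2"
  shows "\<exists>g\<in>carrier SL2. conj_pair g (S1, S2) = (diag_torus, diag_torus) \<or>
    (\<exists>\<alpha>\<in>param_region. conj_pair g (S1, S2) = (conj_set (gmat \<alpha>) diag_torus, diag_torus))"
proof -
  obtain k1 k2 where k: "k1 \<in> carrier SL2" "k2 \<in> carrier SL2"
    and S: "S1 = conj_set k1 diag_torus" "S2 = conj_set k2 diag_torus"
    using assms by (auto simp: maximal_torus_iff_conj_diag_torus)
  let ?h = "adjugate2 k2"
  have h: "?h \<in> carrier SL2" using k by blast
  have hk: "?h ** k1 \<in> carrier SL2" using h k by blast
  have pair: "conj_pair ?h (S1, S2) = (conj_set (?h ** k1) diag_torus, diag_torus)"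
    using h k by (simp add: conj_pair_def S conj_set_conj_set adjugate2_mult)
  from relative_position_normal_form[OF hk] show ?thesis
  proof
    assume "conj_set (?h ** k1) diag_torus = diag_torus"
    with pair h show ?thesis by auto
  next
    assume "\<exists>g\<in>carrier SL2. \<exists>\<alpha>\<in>param_region.
      conj_pair g (conj_set (?h ** k1) diag_torus, diag_torus) =
      (conj_set (gmat \<alpha>) diag_torus, diag_torus)"
    then obtain g \<alpha> where g: "g \<in> carrier SL2" "\<alpha> \<in> param_region"
      "conj_pair g (conj_pair ?h (S1, S2)) = (conj_set (gmat \<alpha>) diag_torus, diag_torus)"
      unfolding pair by blast
    then show ?thesis
      using conj_pair_conj_pair[OF g(1) h] SL2_mult_closed[OF g(1) h] by metis
  qed
qed

section \<open>Separating the orbits\<close>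

text \<open>
  A traceless diagonal matrix of determinant 1 is \<open>diag(r, -r)\<close> with \<open>r\<^sup>2 = -1\<close>; the sign of \<open>r\<close>
  disappears on squaring.
\<close>

lemma trace_invariant_gmat:
  assumes "M \<in> conj_set (gmat \<alpha>) diag_torus" "N \<in> diag_torus" "trace M = 0" "trace N = 0"
  shows "(trace (M ** N))\<^sup>2 = 4 * (1 + 2 * \<alpha>)\<^sup>2"
proof -
  obtain D where D: "D \<in> diag_torus" "M = conj_mat (gmat \<alpha>) D"
    using assms(1) gmat_in_SL2 by (auto simp: conj_set_eq_image)
  have traceless: "\<exists>r. r * r = - 1 \<and> A = mat2 r 0 0 (- r)" if "A \<in> diag_torus" "trace A = 0" for A
  proof -
    have "A $ 2 $ 2 = - A $ 1 $ 1"
      using that(2) by (simp add: trace_def sum_2 add_eq_0_iff)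
    with that(1) show ?thesis
      by (intro exI[of _ "A $ 1 $ 1"]) (auto simp: in_diag_torus_iff mat2_eq_iff minus_equation_iff)
  qed
  have "trace D = 0"
    using assms(3) D(2) gmat_in_SL2 by (simp add: trace_conj_mat)
  then obtain r s where r: "r * r = - 1" "D = mat2 r 0 0 (- r)"
    and s: "s * s = - 1" "N = mat2 s 0 0 (- s)"
    using traceless D(1) assms(2,4) by meson
  have "trace (M ** N) = 2 * r * s * (1 + 2 * \<alpha>)"
    by (simp add: D r s trace_def sum_2 mat2_mult_nth conj_mat_def gmat_eq_mat2 adjugate2_def
        algebra_simps)
  then have "(trace (M ** N))\<^sup>2 = 4 * (r * r) * (s * s) * (1 + 2 * \<alpha>)\<^sup>2"
    by (simp add: power2_eq_square)
  then show ?thesis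
    using r(1) s(1) by simp
qed

lemma gmat_pairs_separated:
  assumes ab: "\<alpha> \<in> param_region" "\<beta> \<in> param_region" and g: "g \<in> carrier SL2"
    and eq: "conj_pair g (conj_set (gmat \<alpha>) diag_torus, diag_torus) =
      (conj_set (gmat \<beta>) diag_torus, diag_torus)"
  shows "\<alpha> = \<beta>"
proof -
  define D where "D = mat2 \<i> 0 0 (- \<i>)"
  define M where "M = conj_mat (gmat \<alpha>) D"
  have D: "D \<in> diag_torus" "trace D = 0"
    by (simp_all add: D_def in_diag_torus_iff trace_def sum_2)
  have M: "M \<in> conj_set (gmat \<alpha>) diag_torus" "trace M = 0"
    using D gmat_in_SL2 by (simp_all add: M_def conj_set_eq_image trace_conj_mat)
  have "conj_mat g M \<in> conj_set (gmat \<beta>) diag_torus" "conj_mat g D \<in> diag_torus"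
    using eq M D g by (auto simp: conj_pair_def conj_set_eq_image[OF g])
  then have "(trace (conj_mat g M ** conj_mat g D))\<^sup>2 = 4 * (1 + 2 * \<beta>)\<^sup>2"
    using M D g by (intro trace_invariant_gmat) (simp_all add: trace_conj_mat)
  moreover have "trace (conj_mat g M ** conj_mat g D) = trace (M ** D)"
    using g by (simp add: conj_mat_mult[symmetric] trace_conj_mat)
  ultimately have "(1 + 2 * \<alpha>)\<^sup>2 = (1 + 2 * \<beta>)\<^sup>2"
    using trace_invariant_gmat[OF M(1) D(1) M(2) D(2)] by simp
  with ab show ?thesis
    by (rule param_region_separates)
qed

text \<open>
  The trace invariant does not exclude \<open>\<alpha> = 0\<close>, where both pairs have the value 4. The off-diagonal
  entries of a conjugated regular element do: they vanish only for \<open>\<alpha> = 0\<close> and \<open>\<alpha> = -1\<close>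
  respectively.
\<close>

lemma conj_gmat_diag_torus_neq: "conj_set (gmat \<alpha>) diag_torus \<noteq> diag_torus"
proof
  assume eq: "conj_set (gmat \<alpha>) diag_torus = diag_torus"
  let ?D = "mat2 2 0 0 (1 / 2)"
  have "?D \<in> diag_torus"
    by (simp add: in_diag_torus_iff)
  then have "conj_mat (gmat \<alpha>) ?D \<in> diag_torus"
    using eq gmat_in_SL2 by (auto simp: conj_set_eq_image)
  then have "\<alpha> = 0" "1 + \<alpha> = 0"
    by (auto simp: in_diag_torus_iff conj_mat_def mat2_mult_nth gmat_eq_mat2 adjugate2_def
        field_simps add_eq_0_iff)
  then show False by simp
qed

lemma conj_set_eq_iff:
  assumes "g \<in> carrier SL2"
  shows "conj_set g S = conj_set g S' \<longleftrightarrow> S = S'"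
  using assms conj_set_conj_set[of "adjugate2 g" g]
  by (metis adjugate2_in_SL2 adjugate2_mult(1) conj_set_one)

definition pair_reps :: "((complex^2^2) set \<times> (complex^2^2) set) set"
  where "pair_reps = {(diag_torus, diag_torus)} \<union>
    {(conj_set (gmat \<alpha>) diag_torus, diag_torus) | \<alpha>. \<alpha> \<in> param_region}"

lemma diag_pair_in_pair_reps: "(diag_torus, diag_torus) \<in> pair_reps"
  by (simp add: pair_reps_def)

lemma gmat_pair_in_pair_reps:
  "\<alpha> \<in> param_region \<Longrightarrow> (conj_set (gmat \<alpha>) diag_torus, diag_torus) \<in> pair_reps"
  by (auto simp: pair_reps_def)

lemma pair_reps_separated:
  assumes "p \<in> pair_reps" "q \<in> pair_reps" and g: "g \<in> carrier SL2" and eq: "conj_pair g p = q"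
  shows "p = q"
proof -
  have diag: "fst p = snd p \<longleftrightarrow> fst q = snd q"
    using eq conj_set_eq_iff[OF g] by (cases p) (auto simp: conj_pair_def)
  show ?thesis
  proof (cases "fst p = snd p")
    case True
    with diag assms(1,2) show ?thesis
      by (auto simp: pair_reps_def conj_gmat_diag_torus_neq)
  next
    case False
    then obtain \<alpha> \<beta> where "\<alpha> \<in> param_region" "\<beta> \<in> param_region"
      "p = (conj_set (gmat \<alpha>) diag_torus, diag_torus)"
      "q = (conj_set (gmat \<beta>) diag_torus, diag_torus)"
      using diag assms(1,2) by (auto simp: pair_reps_def)
    with gmat_pairs_separated[OF _ _ g] eq show ?thesis by metis
  qed
qed

lemma in_own_orbit: "p \<in> orbit SL2 conj_pair p"
proof -
  have "conj_pair (mat 1) p = p"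
    by (cases p) (simp add: conj_pair_def)
  then show ?thesis
    unfolding orbit_def using one_in_SL2 by force
qed

lemma pair_reps_orbits_distinct:
  assumes "p \<in> pair_reps" "q \<in> pair_reps" "orbit SL2 conj_pair p = orbit SL2 conj_pair q"
  shows "p = q"
proof -
  have "q \<in> orbit SL2 conj_pair p"
    using assms(3) in_own_orbit by simp
  then obtain g where "g \<in> carrier SL2" "conj_pair g p = q"
    by (auto simp: orbit_def)
  with assms(1,2) show ?thesis
    by (rule pair_reps_separated)
qed

lemma minimal_orbit_reps_pair_reps: "minimal_orbit_reps SL2 torus_pairs conj_pair pair_reps"
proof -
  have "maximal_torus diag_torus"
    unfolding maximal_torus_iff_conj_diag_torus by (rule bexI[of _ "mat 1"]) simp_all
  moreover have "maximal_torus (conj_set (gmat \<alpha>) diag_torus)" for \<alpha>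
    using gmat_in_SL2 by (auto simp: maximal_torus_iff_conj_diag_torus)
  ultimately have sub: "pair_reps \<subseteq> torus_pairs"
    by (auto simp: pair_reps_def torus_pairs_def)
  have meet: "pair_reps \<inter> Q \<noteq> {}" if Q: "Q \<in> orbits SL2 torus_pairs conj_pair" for Q
  proof -
    obtain p where "p \<in> torus_pairs" and Q: "Q = orbit SL2 conj_pair p"
      using Q by (auto simp: orbits_def)
    then have "\<exists>g\<in>carrier SL2. conj_pair g p \<in> pair_reps"
      using pair_normal_form[of "fst p" "snd p"] by (fastforce simp: torus_pairs_def pair_reps_def)
    then obtain g where "g \<in> carrier SL2" "conj_pair g p \<in> pair_reps" ..
    then show ?thesis
      by (auto simp: Q orbit_def)
  qed
  have miss: "\<exists>Q\<in>orbits SL2 torus_pairs conj_pair. R' \<inter> Q = {}" if R': "R' \<subset> pair_reps" for R'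
  proof -
    obtain r where r: "r \<in> pair_reps" "r \<notin> R'"
      using R' by blast
    then have "orbit SL2 conj_pair r \<in> orbits SL2 torus_pairs conj_pair"
      using sub unfolding orbits_def by blast
    moreover have "R' \<inter> orbit SL2 conj_pair r = {}"
    proof (rule ccontr)
      assume "R' \<inter> orbit SL2 conj_pair r \<noteq> {}"
      then obtain g where g: "g \<in> carrier SL2" "conj_pair g r \<in> R'"
        by (auto simp: orbit_def)
      then have "r = conj_pair g r"
        using R' by (intro pair_reps_separated[OF r(1) _ g(1)]) auto
      with g(2) r(2) show False by simp
    qed
    ultimately show ?thesis by blast
  qed
  show ?thesis
    unfolding minimal_orbit_reps_def
    by (intro conjI ballI allI impI) (rule sub meet miss, assumption?)+
qed

theorem theorem2:
  shows "minimal_orbit_reps SL2 torus_pairs conj_pair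
      ({(diag_torus, diag_torus)} \<union>
       {(conj_set (gmat \<alpha>) diag_torus, diag_torus) | \<alpha>. \<alpha> \<in> param_region})
    \<and> (\<forall>S1 S2. maximal_torus S1 \<and> maximal_torus S2 \<longrightarrow>
        (\<exists>g \<in> carrier SL2.
          conj_pair g (S1, S2) = (diag_torus, diag_torus) \<or>
          (\<exists>\<alpha> \<in> param_region.
            conj_pair g (S1, S2) = (conj_set (gmat \<alpha>) diag_torus, diag_torus))))
    \<and> (\<forall>\<alpha> \<in> param_region.
        orbit SL2 conj_pair (conj_set (gmat \<alpha>) diag_torus, diag_torus) \<noteq>
        orbit SL2 conj_pair (diag_torus, diag_torus))
    \<and> (\<forall>\<alpha> \<in> param_region. \<forall>\<beta> \<in> param_region. \<alpha> \<noteq> \<beta> \<longrightarrow>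
        orbit SL2 conj_pair (conj_set (gmat \<alpha>) diag_torus, diag_torus) \<noteq>
        orbit SL2 conj_pair (conj_set (gmat \<beta>) diag_torus, diag_torus))"
proof (intro conjI allI ballI impI)
  show "minimal_orbit_reps SL2 torus_pairs conj_pair
      ({(diag_torus, diag_torus)} \<union>
       {(conj_set (gmat \<alpha>) diag_torus, diag_torus) | \<alpha>. \<alpha> \<in> param_region})"
    using minimal_orbit_reps_pair_reps unfolding pair_reps_def .
next
  fix S1 S2 assume "maximal_torus S1 \<and> maximal_torus S2"
  then show "\<exists>g \<in> carrier SL2.
          conj_pair g (S1, S2) = (diag_torus, diag_torus) \<or>
          (\<exists>\<alpha> \<in> param_region.
            conj_pair g (S1, S2) = (conj_set (gmat \<alpha>) diag_torus, diag_torus))"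
    using pair_normal_form by blast
next
  fix \<alpha> assume "\<alpha> \<in> param_region"
  then show "orbit SL2 conj_pair (conj_set (gmat \<alpha>) diag_torus, diag_torus) \<noteq>
        orbit SL2 conj_pair (diag_torus, diag_torus)"
    using pair_reps_orbits_distinct[OF gmat_pair_in_pair_reps diag_pair_in_pair_reps]
      conj_gmat_diag_torus_neq by auto
next
  fix \<alpha> \<beta> assume ab: "\<alpha> \<in> param_region" "\<beta> \<in> param_region" "\<alpha> \<noteq> \<beta>"
  show "orbit SL2 conj_pair (conj_set (gmat \<alpha>) diag_torus, diag_torus) \<noteq>
        orbit SL2 conj_pair (conj_set (gmat \<beta>) diag_torus, diag_torus)"
  proof
    assume "orbit SL2 conj_pair (conj_set (gmat \<alpha>) diag_torus, diag_torus) =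
        orbit SL2 conj_pair (conj_set (gmat \<beta>) diag_torus, diag_torus)"
    then have "conj_set (gmat \<alpha>) diag_torus = conj_set (gmat \<beta>) diag_torus"
      using pair_reps_orbits_distinct[OF gmat_pair_in_pair_reps[OF ab(1)]
          gmat_pair_in_pair_reps[OF ab(2)]] by simp
    then have "conj_pair (mat 1) (conj_set (gmat \<alpha>) diag_torus, diag_torus) =
        (conj_set (gmat \<beta>) diag_torus, diag_torus)"
      by (simp add: conj_pair_def)
    with ab show False
      using gmat_pairs_separated[OF ab(1,2) one_in_SL2] by simp
  qed
qed

end
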